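(* The pull-in voltage $\lambda_\delta^*$ of $(F_{\lambda,\delta})$ tends to $0$ as $\delta\to\infty$; that is, $$\lim_{\delta\to\infty}\lambda_\delta^*=0 .$$
   Context: $\Omega\subset\mathbb{R}^n$ is a fixed bounded domain. For $\delta>0$, the pull-in voltage $\lambda_\delta^*\in(0,\infty)$ is the critical value such that the stationary problem $$-\Delta u=\lambda\frac{1+\delta|\nabla u|^2}{(1-u)^2}\ \text{ in }\Omega,\qquad u=0\ \text{ on }\partial\Omega$$ has no solution for $\lambda>\lambda_\delta^*$ and has a solution for $0<\lambda\le\lambda_\delta^*$. Equivalently, it is the threshold such that the solution of the parabolic problem $(F_{\lambda,\delta})$, namely $u_t-\Delta u=\lambda\frac{1+\delta|\nabla u|^2}{(1-u)^2}$ in $\Omega$ with $u=0$ on $\partial\Omega$ and $u(\cdot,0)=0$, is global for $\lambda\le\lambda_\delta^*$ and quenches (reaches the value $1$) in finite time for $\lambda>\lambda_\delta^*$. *)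

theory Defs
  imports "HOL-Analysis.Analysis"
begin

definition gradient :: "('a::euclidean_space \<Rightarrow> real) \<Rightarrow> 'a \<Rightarrow> 'a" where
  "gradient u x = (THE D. GDERIV u x :> D)"

lemma gradient_eqI:
  assumes "GDERIV u x :> D"
  shows "gradient u x = D"
  unfolding gradient_def
proof (rule the_equality[where P = "\<lambda>D. GDERIV u x :> D", OF assms])
  fix D' assume "GDERIV u x :> D'"
  have "(\<lambda>h. h \<bullet> D') = (\<lambda>h. h \<bullet> D)"
    using \<open>GDERIV u x :> D'\<close> assms unfolding gderiv_def by (rule has_derivative_unique)
  then have "h \<bullet> D' = h \<bullet> D" for h
    by (rule fun_cong)
  then show "D' = D"
    by (metis inner_commute vector_eq_rdot)
qed

text \<open>The divergence of the gradient, i.e. the trace of the Hessian.\<close>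

definition laplacian :: "('a::euclidean_space \<Rightarrow> real) \<Rightarrow> 'a \<Rightarrow> real" where
  "laplacian u x = (\<Sum>b\<in>Basis. frechet_derivative (gradient u) (at x) b \<bullet> b)"

text \<open>In finite dimension, continuity of the second derivative in operator norm is continuity
  of its value at each fixed vector. For open \<open>\<Omega>\<close> this is the usual space of twice
  continuously differentiable functions.\<close>

definition C2_on :: "'a::euclidean_space set \<Rightarrow> ('a \<Rightarrow> real) \<Rightarrow> bool" where
  "C2_on \<Omega> u \<longleftrightarrow>
     (\<forall>x\<in>\<Omega>. u differentiable (at x)) \<and>
     (\<forall>x\<in>\<Omega>. gradient u differentiable (at x)) \<and>
     (\<forall>h. continuous_on \<Omega> (\<lambda>x. frechet_derivative (gradient u) (at x) h))"

text \<open>Classical solutions; \<open>\<mu>\<close> is the voltage. The condition \<open>u < 1\<close>, implicit in the singular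
  right-hand side, has to be explicit because division is total.\<close>

definition stationary_solution ::
    "'a::euclidean_space set \<Rightarrow> real \<Rightarrow> real \<Rightarrow> ('a \<Rightarrow> real) \<Rightarrow> bool" where
  "stationary_solution \<Omega> \<mu> \<delta> u \<longleftrightarrow>
     C2_on \<Omega> u \<and> continuous_on (closure \<Omega>) u \<and>
     (\<forall>x\<in>\<Omega>. u x < 1) \<and>
     (\<forall>x\<in>\<Omega>. - laplacian u x = \<mu> * (1 + \<delta> * (norm (gradient u x))\<^sup>2) / (1 - u x)\<^sup>2) \<and>
     (\<forall>x\<in>frontier \<Omega>. u x = 0)"

text \<open>A predicate rather than a function, since for irregular domains there may be no solution
  for any \<open>\<mu> > 0\<close>, hence no critical value.\<close>

definition is_pull_in_voltage :: "'a::euclidean_space set \<Rightarrow> real \<Rightarrow> real \<Rightarrow> bool" where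
  "is_pull_in_voltage \<Omega> \<delta> L \<longleftrightarrow>
     L > 0 \<and>
     (\<forall>\<mu>>L. \<not> (\<exists>u. stationary_solution \<Omega> \<mu> \<delta> u)) \<and>
     (\<forall>\<mu>. 0 < \<mu> \<and> \<mu> \<le> L \<longrightarrow> (\<exists>u. stationary_solution \<Omega> \<mu> \<delta> u))"

lemma is_pull_in_voltage_unique:
  assumes "is_pull_in_voltage \<Omega> \<delta> L" "is_pull_in_voltage \<Omega> \<delta> L'"
  shows "L = L'"
proof (rule antisym)
  show "L \<le> L'" "L' \<le> L"
    using assms unfolding is_pull_in_voltage_def by (force simp: not_le[symmetric])+
qed

end

theory Submission
  imports Defs
begin

text \<open>
  A solution at voltage \<open>\<mu>\<close> is nonnegative by the minimum principle, so
  \<open>-\<Delta>u \<ge> \<mu> (1 + \<delta> |\<nabla>u|\<^sup>2)\<close>: the singular factor only helps. The Hopf--Cole substitution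
  \<open>v = exp (\<mu>\<delta> u)\<close> absorbs the gradient term and yields \<open>-\<Delta>v \<ge> \<mu>\<^sup>2 \<delta> v\<close> with \<open>v > 0\<close>. A positive
  supersolution of this kind can exist only if \<open>\<mu>\<^sup>2 \<delta>\<close> does not exceed the first Dirichlet
  eigenvalue of any ball inside \<open>\<Omega>\<close>; hence \<open>\<mu> = O(\<delta>\<^sup>-\<^sup>1\<^sup>/\<^sup>2)\<close>.

  Instead of an eigenfunction, the proof compares \<open>v\<close> with the explicit bump \<open>s\<^sup>2\<close>, where
  \<open>s = r\<^sup>2 - |x - c|\<^sup>2\<close> on a ball of centre \<open>c\<close> and radius \<open>r\<close>. The quotient \<open>s\<^sup>2 / v\<close> attains its
  maximum inside the ball, and there \<open>\<mu>\<delta> u - 2 ln s\<close> has a local minimum. The first and second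
  order conditions (\<open>local_min_gradient_zero\<close>, \<open>local_min_hessian_nonneg\<close>) turn the differential
  inequality into a quadratic inequality for \<open>s\<close>, which has a real solution only if \<open>2 r\<^sup>2 \<mu>\<^sup>2 \<delta> \<le> (n + 2)\<^sup>2\<close>
  (\<open>stationary_solution_voltage_bound\<close>).
\<close>

lemma DERIV2_nonneg_at_local_min:
  fixes f f' :: "real \<Rightarrow> real"
  assumes f: "eventually (\<lambda>t. (f has_real_derivative f' t) (at t)) (nhds t0)"
    and f': "(f' has_real_derivative D) (at t0)"
    and min: "eventually (\<lambda>t. f t0 \<le> f t) (nhds t0)"
  shows "D \<ge> 0"
proof (rule ccontr)
  assume "\<not> D \<ge> 0"
  then have "D < 0" by simp
  from eventually_conj[OF f min] obtain e where e: "e > 0"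
    and d: "\<And>t. dist t t0 < e \<Longrightarrow> (f has_real_derivative f' t) (at t)"
    and m: "\<And>t. dist t t0 < e \<Longrightarrow> f t0 \<le> f t"
    unfolding eventually_nhds_metric by blast
  have f'0: "f' t0 = 0"
    using DERIV_local_min[OF d[of t0] e] e m by (simp add: dist_real_def abs_minus_commute)
  from DERIV_neg_dec_right[OF f' \<open>D < 0\<close>] obtain k where k: "k > 0"
    and neg: "\<And>h. 0 < h \<Longrightarrow> h < k \<Longrightarrow> f' (t0 + h) < 0"
    unfolding f'0 by blast
  define t1 where "t1 = t0 + min e k / 2"
  have t1: "t0 < t1" "t1 < t0 + e" "t1 < t0 + k" using e k by (auto simp: t1_def)
  have "f t1 < f t0"
  proof (rule DERIV_neg_imp_decreasing_open[OF t1(1)])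
    fix x assume x: "t0 < x" "x < t1"
    then show "\<exists>y. (f has_real_derivative y) (at x) \<and> y < 0"
      using d[of x] neg[of "x - t0"] t1 by (auto simp: dist_real_def)
  next
    show "continuous_on {t0..t1} f"
      using t1 by (auto intro!: continuous_at_imp_continuous_on DERIV_isCont[OF d]
          simp: dist_real_def)
  qed
  with m[of t1] t1 show False by (simp add: dist_real_def)
qed

lemma local_min_gradient_zero:
  fixes g :: "'a::euclidean_space \<Rightarrow> real"
  assumes "GDERIV g x0 :> D" and "eventually (\<lambda>x. g x0 \<le> g x) (nhds x0)"
  shows "D = 0"
proof -
  have "eventually (\<lambda>x. g x0 \<le> g x) (at x0)"
    using assms(2) eventually_nhds_conv_at by blast
  from has_derivative_local_min[OF assms(1)[unfolded gderiv_def] this]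
  have "D \<bullet> D = 0" by meson
  then show ?thesis by simp
qed

lemma local_min_hessian_nonneg:
  fixes g :: "'a::euclidean_space \<Rightarrow> real"
  assumes g: "eventually (\<lambda>x. GDERIV g x :> G x) (nhds x0)"
    and G: "(G has_derivative H) (at x0)"
    and min: "eventually (\<lambda>x. g x0 \<le> g x) (nhds x0)"
  shows "H b \<bullet> b \<ge> 0"
proof -
  define p where "p t = x0 + t *\<^sub>R b" for t :: real
  have p0: "p 0 = x0" by (simp add: p_def)
  have p: "(p has_derivative (\<lambda>h. h *\<^sub>R b)) (at t)" for t
    unfolding p_def by (auto intro!: derivative_eq_intros)
  have "isCont p 0" using p has_derivative_continuous by blast
  then have lim: "filterlim p (nhds x0) (nhds 0)"
    unfolding isCont_def p0 by (metis p0 tendsto_at_iff_tendsto_nhds)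
  show ?thesis
  proof (rule DERIV2_nonneg_at_local_min)
    show "eventually (\<lambda>t. ((\<lambda>t. g (p t)) has_real_derivative G (p t) \<bullet> b) (at t)) (nhds 0)"
      using eventually_compose_filterlim[OF g lim]
    proof eventually_elim
      case (elim t)
      have "((\<lambda>t. g (p t)) has_derivative (\<lambda>h. (h *\<^sub>R b) \<bullet> G (p t))) (at t)"
        using has_derivative_compose[OF p elim[unfolded gderiv_def]] .
      then show ?case
        by (rule has_derivative_imp_has_field_derivative) (simp add: inner_commute)
    qed
    have "((\<lambda>t. G (p t)) has_derivative (\<lambda>h. H (h *\<^sub>R b))) (at 0)"
      using has_derivative_compose[OF p[of 0], of G H] G by (simp add: p0)
    then have "((\<lambda>t. G (p t) \<bullet> b) has_derivative (\<lambda>h. H (h *\<^sub>R b) \<bullet> b)) (at 0)"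
      by (rule has_derivative_inner_left)
    then show "((\<lambda>t. G (p t) \<bullet> b) has_real_derivative H b \<bullet> b) (at 0)"
      by (rule has_derivative_imp_has_field_derivative)
        (simp add: linear_scale[OF has_derivative_linear[OF G]])
    show "eventually (\<lambda>t. g (p 0) \<le> g (p t)) (nhds 0)"
      unfolding p0 by (rule eventually_compose_filterlim[OF min lim])
  qed
qed

lemma C2_on_GDERIV_gradient:
  assumes "C2_on \<Omega> u" "x \<in> \<Omega>"
  shows "GDERIV u x :> gradient u x"
proof -
  obtain D where D: "(u has_derivative D) (at x)"
    using assms by (auto simp: C2_on_def differentiable_def)
  have lin: "linear D" by (rule has_derivative_linear[OF D])
  have "D = (\<lambda>h. h \<bullet> (\<Sum>b\<in>Basis. D b *\<^sub>R b))"
  proof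
    fix h
    have "D h = D (\<Sum>b\<in>Basis. (h \<bullet> b) *\<^sub>R b)" by (simp add: euclidean_representation)
    also have "\<dots> = (\<Sum>b\<in>Basis. (h \<bullet> b) * D b)"
      by (simp add: linear_sum[OF lin] linear_scale[OF lin])
    also have "\<dots> = h \<bullet> (\<Sum>b\<in>Basis. D b *\<^sub>R b)"
      by (simp add: inner_sum_right mult.commute)
    finally show "D h = h \<bullet> (\<Sum>b\<in>Basis. D b *\<^sub>R b)" .
  qed
  with D have "GDERIV u x :> (\<Sum>b\<in>Basis. D b *\<^sub>R b)" by (simp add: gderiv_def)
  then show ?thesis using gradient_eqI by metis
qed

lemma C2_on_gradient_has_derivative:
  assumes "C2_on \<Omega> u" "x \<in> \<Omega>"
  shows "(gradient u has_derivative frechet_derivative (gradient u) (at x)) (at x)"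
  using assms by (auto simp: C2_on_def frechet_derivative_works[symmetric])

text \<open>The minimum principle: a strictly superharmonic function has no interior minimum, so it is
  bounded below by its boundary values.\<close>

lemma superharmonic_nonneg:
  fixes u :: "'a::euclidean_space \<Rightarrow> real"
  assumes "open \<Omega>" "bounded \<Omega>" and C2: "C2_on \<Omega> u"
    and cont: "continuous_on (closure \<Omega>) u"
    and sup: "\<And>x. x \<in> \<Omega> \<Longrightarrow> laplacian u x < 0"
    and bd: "\<And>x. x \<in> frontier \<Omega> \<Longrightarrow> u x \<ge> 0"
    and "x \<in> \<Omega>"
  shows "u x \<ge> 0"
proof -
  have "compact (closure \<Omega>)" "closure \<Omega> \<noteq> {}"
    using assms by (auto simp: compact_closure)
  from continuous_attains_inf[OF this cont] obtain m
    where m: "m \<in> closure \<Omega>" and min: "\<And>y. y \<in> closure \<Omega> \<Longrightarrow> u m \<le> u y" by blast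
  have "m \<notin> \<Omega>"
  proof
    assume "m \<in> \<Omega>"
    have near: "eventually (\<lambda>y. y \<in> \<Omega>) (nhds m)"
      using \<open>open \<Omega>\<close> \<open>m \<in> \<Omega>\<close> by (rule eventually_nhds_in_open)
    have "frechet_derivative (gradient u) (at m) b \<bullet> b \<ge> 0" for b
    proof (rule local_min_hessian_nonneg)
      show "eventually (\<lambda>y. GDERIV u y :> gradient u y) (nhds m)"
        using near by eventually_elim (rule C2_on_GDERIV_gradient[OF C2])
      show "(gradient u has_derivative frechet_derivative (gradient u) (at m)) (at m)"
        by (rule C2_on_gradient_has_derivative[OF C2 \<open>m \<in> \<Omega>\<close>])
      show "eventually (\<lambda>y. u m \<le> u y) (nhds m)"
        using near by eventually_elim (use min closure_subset in blast)
    qed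
    then have "laplacian u m \<ge> 0" by (simp add: laplacian_def sum_nonneg)
    with sup[OF \<open>m \<in> \<Omega>\<close>] show False by simp
  qed
  then have "m \<in> frontier \<Omega>" using m \<open>open \<Omega>\<close> by (simp add: frontier_def interior_open)
  from bd[OF this] min[of x] \<open>x \<in> \<Omega>\<close> closure_subset show ?thesis by fastforce
qed

text \<open>The comparison of \<open>exp (a u)\<close> with the bump \<open>s\<^sup>2\<close>. The hypothesis says precisely that
  \<open>exp (a u)\<close> is a supersolution of \<open>-\<Delta>v = K v\<close>; the logarithmic form avoids differentiating the
  exponential.\<close>

lemma riccati_supersolution_bound:
  fixes u :: "'a::euclidean_space \<Rightarrow> real"
  assumes C2: "C2_on \<Omega> u" and r: "r > 0" and sub: "cball c r \<subseteq> \<Omega>"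
    and K: "K > 0"
    and super: "\<And>x. x \<in> \<Omega> \<Longrightarrow> K + (norm (a *\<^sub>R gradient u x))\<^sup>2 \<le> - (a * laplacian u x)"
  shows "2 * r\<^sup>2 * K \<le> (real DIM('a) + 2)\<^sup>2"
proof -
  define s where "s x = r\<^sup>2 - (norm (x - c))\<^sup>2" for x
  have u_at: "GDERIV u x :> gradient u x" if "x \<in> cball c r" for x
    using that sub by (intro C2_on_GDERIV_gradient[OF C2]) blast
  have ucont: "continuous_on (cball c r) u"
  proof (intro continuous_at_imp_continuous_on ballI)
    fix x assume "x \<in> cball c r"
    from u_at[OF this] show "isCont u x"
      unfolding gderiv_def by (rule has_derivative_continuous)
  qed
  have "continuous_on (cball c r) (\<lambda>x. (s x)\<^sup>2 * exp (- a * u x))"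
    unfolding s_def by (intro continuous_intros ucont)
  moreover have "cball c r \<noteq> {}" using r by simp
  ultimately obtain x0 where x0: "x0 \<in> cball c r"
    and max: "\<And>y. y \<in> cball c r \<Longrightarrow> (s y)\<^sup>2 * exp (- a * u y) \<le> (s x0)\<^sup>2 * exp (- a * u x0)"
    using continuous_attains_sup[OF compact_cball] by blast
  have s_pos: "s y > 0" if "y \<in> ball c r" for y
  proof -
    have "norm (y - c) < r" using that by (simp add: dist_norm norm_minus_commute)
    then show ?thesis by (simp add: s_def power2_strict_mono)
  qed
  \<comment> \<open>The bump vanishes on the sphere, so the maximum is attained in the open ball.\<close>
  have "0 < (s c)\<^sup>2 * exp (- a * u c)" using r by (simp add: s_def)
  also have "\<dots> \<le> (s x0)\<^sup>2 * exp (- a * u x0)" using r by (intro max) simp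
  finally have "s x0 \<noteq> 0" by auto
  then have "norm (x0 - c) \<noteq> r" by (auto simp: s_def)
  with x0 have ball: "x0 \<in> ball c r" by (simp add: dist_norm norm_minus_commute)
  have near: "eventually (\<lambda>y. y \<in> ball c r) (nhds x0)"
    using ball by (intro eventually_nhds_in_open) auto

  define g where "g x = a * u x - 2 * ln (s x)" for x
  define G where "G x = a *\<^sub>R gradient u x + (4 / s x) *\<^sub>R (x - c)" for x
  define H where "H h = a *\<^sub>R frechet_derivative (gradient u) (at x0) h
      + ((4 / s x0) *\<^sub>R h + (8 * (h \<bullet> (x0 - c)) / (s x0)\<^sup>2) *\<^sub>R (x0 - c))" for h
  have s_deriv: "(s has_derivative (\<lambda>h. - 2 * (h \<bullet> (x - c)))) (at x)" for x
    unfolding s_def power2_norm_eq_inner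
    by (auto intro!: derivative_eq_intros simp: inner_commute)
  have g_deriv: "GDERIV g y :> G y" if "y \<in> ball c r" for y
  proof -
    have "(u has_derivative (\<lambda>h. h \<bullet> gradient u y)) (at y)"
      using u_at[of y] that by (simp add: gderiv_def)
    note du = has_derivative_mult_right[OF this, of a]
    have "((\<lambda>x. ln (s x)) has_derivative (\<lambda>h. (- 2 * (h \<bullet> (y - c))) * (1 / s y))) (at y)"
      using has_derivative_ln[OF s_pos[OF that] s_deriv] by (simp add: divide_inverse mult.commute)
    from has_derivative_diff[OF du has_derivative_mult_right[OF this, of 2]] show ?thesis
      unfolding gderiv_def g_def G_def by (simp add: inner_add_right)
  qed
  have g_min: "eventually (\<lambda>y. g x0 \<le> g y) (nhds x0)"
    using near
  proof eventually_elim
    case (elim y)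
    have "ln ((s y)\<^sup>2 * exp (- a * u y)) \<le> ln ((s x0)\<^sup>2 * exp (- a * u x0))"
      using max[of y] elim s_pos[OF elim] s_pos[OF ball] by (subst ln_le_cancel_iff) auto
    then show ?case
      using s_pos[OF elim] s_pos[OF ball] by (simp add: g_def ln_mult ln_realpow)
  qed
  have G_deriv: "(G has_derivative H) (at x0)"
  proof -
    have "(gradient u has_derivative frechet_derivative (gradient u) (at x0)) (at x0)"
      using x0 sub by (intro C2_on_gradient_has_derivative[OF C2]) blast
    note grad = has_derivative_scaleR_right[OF this, of a]
    have "((\<lambda>x. 4 / s x) has_derivative (\<lambda>h. 8 * (h \<bullet> (x0 - c)) / (s x0)\<^sup>2)) (at x0)"
      using has_derivative_divide[OF has_derivative_const[of 4] s_deriv, of x0] s_pos[OF ball]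
      by (simp add: power2_eq_square divide_inverse mult_ac)
    moreover have "((\<lambda>x. x - c) has_derivative (\<lambda>h. h)) (at x0)"
      by (auto intro!: derivative_eq_intros)
    ultimately have "((\<lambda>x. (4 / s x) *\<^sub>R (x - c)) has_derivative
        (\<lambda>h. (4 / s x0) *\<^sub>R h + (8 * (h \<bullet> (x0 - c)) / (s x0)\<^sup>2) *\<^sub>R (x0 - c))) (at x0)"
      by (rule has_derivative_scaleR)
    from has_derivative_add[OF grad this] show ?thesis
      unfolding G_def H_def .
  qed
  have "H b \<bullet> b \<ge> 0" for b
    by (rule local_min_hessian_nonneg[OF _ G_deriv g_min])
      (use near in eventually_elim, rule g_deriv)
  then have "0 \<le> (\<Sum>b\<in>Basis. H b \<bullet> b)" by (simp add: sum_nonneg)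
  also have "\<dots> = a * laplacian u x0 + 4 * DIM('a) / s x0
      + 8 / (s x0)\<^sup>2 * (\<Sum>b\<in>Basis. ((x0 - c) \<bullet> b)\<^sup>2)"
  proof -
    have "H b \<bullet> b = a * (frechet_derivative (gradient u) (at x0) b \<bullet> b) + 4 / s x0
        + 8 / (s x0)\<^sup>2 * ((x0 - c) \<bullet> b)\<^sup>2" if "b \<in> Basis" for b
      using that
      by (simp add: H_def inner_add_left power2_eq_square[of "(x0 - c) \<bullet> b"]
          inner_commute[of b "x0 - c"])
    then show ?thesis
      by (simp add: laplacian_def sum.distrib sum_distrib_left)
  qed
  also have "(\<Sum>b\<in>Basis. ((x0 - c) \<bullet> b)\<^sup>2) = (norm (x0 - c))\<^sup>2"
    by (subst power2_norm_eq_inner, subst euclidean_inner) (simp add: power2_eq_square)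
  finally have lap: "- (a * laplacian u x0)
      \<le> 4 * DIM('a) / s x0 + 8 / (s x0)\<^sup>2 * (norm (x0 - c))\<^sup>2" by simp
  have "G x0 = 0" using local_min_gradient_zero[OF g_deriv[OF ball] g_min] .
  then have "a *\<^sub>R gradient u x0 = - ((4 / s x0) *\<^sub>R (x0 - c))"
    by (simp add: G_def eq_neg_iff_add_eq_0)
  then have "(norm (a *\<^sub>R gradient u x0))\<^sup>2 = 16 / (s x0)\<^sup>2 * (norm (x0 - c))\<^sup>2"
    by (simp add: power_mult_distrib power_divide)
  with super[of x0] lap x0 sub
  have "K + 8 / (s x0)\<^sup>2 * (norm (x0 - c))\<^sup>2 \<le> 4 * DIM('a) / s x0"
    by (auto simp: subset_iff)
  from mult_right_mono[OF this, of "(s x0)\<^sup>2"]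
  have "K * (s x0)\<^sup>2 + 8 * (norm (x0 - c))\<^sup>2 \<le> 4 * DIM('a) * s x0"
    using s_pos[OF ball] by (simp add: distrib_right power2_eq_square)
  then have quad: "K * (s x0)\<^sup>2 + 8 * r\<^sup>2 \<le> 4 * (real DIM('a) + 2) * s x0"
    by (simp add: s_def algebra_simps)
  \<comment> \<open>Completing the square: a real solution forces a nonnegative discriminant.\<close>
  have "0 \<le> (K * s x0 - 2 * (real DIM('a) + 2))\<^sup>2" by simp
  also have "\<dots> = K * (K * (s x0)\<^sup>2 - 4 * (real DIM('a) + 2) * s x0)
      + 4 * (real DIM('a) + 2)\<^sup>2"
    by (simp add: power2_eq_square algebra_simps)
  also have "\<dots> \<le> K * (- 8 * r\<^sup>2) + 4 * (real DIM('a) + 2)\<^sup>2"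
    using quad K by (intro add_right_mono mult_left_mono) auto
  finally show ?thesis by (simp add: algebra_simps)
qed

text \<open>With \<open>a = \<mu>\<delta>\<close>, multiplying the equation by \<open>a\<close> makes the gradient term exactly
  \<open>|\<nabla>(a u)|\<^sup>2\<close> and leaves the constant \<open>K = \<mu>\<^sup>2 \<delta>\<close>.\<close>

lemma stationary_solution_voltage_bound:
  fixes \<Omega> :: "'a::euclidean_space set"
  assumes "open \<Omega>" "bounded \<Omega>" and r: "r > 0" "cball c r \<subseteq> \<Omega>"
    and \<mu>: "\<mu> > 0" and \<delta>: "\<delta> > 0"
    and sol: "stationary_solution \<Omega> \<mu> \<delta> u"
  shows "2 * r\<^sup>2 * (\<mu>\<^sup>2 * \<delta>) \<le> (real DIM('a) + 2)\<^sup>2"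
proof (rule riccati_supersolution_bound[OF _ r])
  show C2: "C2_on \<Omega> u" using sol by (simp add: stationary_solution_def)
  show "\<mu>\<^sup>2 * \<delta> > 0" using \<mu> \<delta> by simp
  fix x assume x: "x \<in> \<Omega>"
  have lt1: "u y < 1" and eq: "- laplacian u y = \<mu> * (1 + \<delta> * (norm (gradient u y))\<^sup>2) / (1 - u y)\<^sup>2"
    if "y \<in> \<Omega>" for y
    using sol that by (auto simp: stationary_solution_def)
  have num: "\<mu> * (1 + \<delta> * (norm (gradient u y))\<^sup>2) > 0" for y
    using \<mu> \<delta> by (intro mult_pos_pos add_pos_nonneg) auto
  have "u x \<ge> 0"
  proof (rule superharmonic_nonneg[OF \<open>open \<Omega>\<close> \<open>bounded \<Omega>\<close> C2 _ _ _ x])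
    fix y assume "y \<in> \<Omega>"
    then have "- laplacian u y > 0"
      using eq num[of y] lt1[of y] by (simp only: eq) (auto intro!: divide_pos_pos)
    then show "laplacian u y < 0" by simp
  qed (use sol in \<open>auto simp: stationary_solution_def\<close>)
  then have "(1 - u x)\<^sup>2 \<le> 1" "(1 - u x)\<^sup>2 > 0"
    using lt1[OF x] by (auto simp: power_le_one)
  then have "\<mu> * (1 + \<delta> * (norm (gradient u x))\<^sup>2) \<le> - laplacian u x"
    unfolding eq[OF x] using num[of x] by (simp add: le_divide_eq mult_left_le)
  then have "(\<mu> * \<delta>) * (\<mu> * (1 + \<delta> * (norm (gradient u x))\<^sup>2)) \<le> (\<mu> * \<delta>) * (- laplacian u x)"
    using \<mu> \<delta> by (intro mult_left_mono) auto
  moreover have "(norm ((\<mu> * \<delta>) *\<^sub>R gradient u x))\<^sup>2 = (\<mu> * \<delta>)\<^sup>2 * (norm (gradient u x))\<^sup>2"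
    by (simp add: power_mult_distrib)
  ultimately show "\<mu>\<^sup>2 * \<delta> + (norm ((\<mu> * \<delta>) *\<^sub>R gradient u x))\<^sup>2 \<le> - (\<mu> * \<delta> * laplacian u x)"
    by (simp only: power_mult_distrib) (simp add: power2_eq_square algebra_simps)
qed

theorem proposition3p2:
  fixes \<Omega> :: "'a::euclidean_space set"
    and lambda_star :: "real \<Rightarrow> real"
  assumes "open \<Omega>" and "connected \<Omega>" and "bounded \<Omega>" and "\<Omega> \<noteq> {}"
    and "\<And>\<delta>. \<delta> > 0 \<Longrightarrow> is_pull_in_voltage \<Omega> \<delta> (lambda_star \<delta>)"
  shows "(lambda_star \<longlongrightarrow> 0) at_top"
proof -
  obtain c r where r: "r > 0" "cball c r \<subseteq> \<Omega>"
    using \<open>open \<Omega>\<close> \<open>\<Omega> \<noteq> {}\<close> open_contains_cball by blast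
  define C where "C = (real DIM('a) + 2)\<^sup>2 / (2 * r\<^sup>2)"
  have pos: "0 < lambda_star \<delta>" and bound: "lambda_star \<delta> \<le> sqrt (C / \<delta>)" if \<delta>: "\<delta> > 0" for \<delta>
  proof -
    show pos: "0 < lambda_star \<delta>"
      using assms(5)[OF \<delta>] by (simp add: is_pull_in_voltage_def)
    then obtain u where "stationary_solution \<Omega> (lambda_star \<delta>) \<delta> u"
      using assms(5)[OF \<delta>] by (auto simp: is_pull_in_voltage_def)
    from stationary_solution_voltage_bound[OF assms(1,3) r pos \<delta> this]
    have "(lambda_star \<delta>)\<^sup>2 \<le> C / \<delta>"
      using \<delta> r by (simp add: C_def field_simps)
    then show "lambda_star \<delta> \<le> sqrt (C / \<delta>)" by (rule real_le_rsqrt)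
  qed
  have "((\<lambda>\<delta>. sqrt (C / \<delta>)) \<longlongrightarrow> sqrt 0) at_top"
    by (intro tendsto_real_sqrt tendsto_divide_0[OF tendsto_const]
        filterlim_at_top_imp_at_infinity filterlim_ident)
  then have upper: "((\<lambda>\<delta>. sqrt (C / \<delta>)) \<longlongrightarrow> 0) at_top" by simp
  show ?thesis
  proof (rule tendsto_sandwich[OF _ _ tendsto_const upper])
    show "eventually (\<lambda>\<delta>. 0 \<le> lambda_star \<delta>) at_top"
      using eventually_gt_at_top[of 0] by eventually_elim (simp add: pos less_imp_le)
    show "eventually (\<lambda>\<delta>. lambda_star \<delta> \<le> sqrt (C / \<delta>)) at_top"
      using eventually_gt_at_top[of 0] by eventually_elim (rule bound)
  qed
qed

end
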